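(* Let $n\ge 4$ be an even integer. The polytope $\operatorname{DP}_n$ is (up to affine isomorphism) a join $Q_{n/2}\star Q_{n/2}$ of two copies of $Q_{n/2}$. In particular, its dimension is $2n-3$.
   Context: Dihedral permutation polytope: permutations act from the right, and a permutation $\sigma\in S_n$ is represented by the $n\times n$ permutation matrix $M_\sigma$ with entries $\delta_{i,(j)\sigma}$. The dihedral group $D_n\le S_n$ of order $2n$ is the symmetry group of the regular $n$-gon acting on its $n$ vertices; for $n$ even it is generated by $\rho=(1,2,\ldots,n)$ and $\tau=(2,n)(3,n-1)\cdots(n/2,(n/2)+2)$. Define $\operatorname{DP}_n=\operatorname{conv}(M_\sigma : \sigma\in D_n)\subset\mathbb{R}^{n\times n}$. Polytope $Q_m$ (for an integer $m\ge 2$): let $I$ be the $m\times m$ identity matrix and let $R$ be the $m\times m$ matrix, with rows and columns indexed by $0,\ldots,m-1$, whose entry at $(i,j)$ is $1$ if $j\equiv i+1\bmod m$ and $0$ otherwise. Then $Q_m\subset\mathbb{R}^{m^2}$ is the convex hull of the rows of the $2m\times m^2$ block matrix $$\begin{bmatrix} I & I & I & \cdots & I\\ I & R^1 & R^2 & \cdots & R^{m-1}\end{bmatrix}.$$ The join $P\star Q$ of two polytopes $P$ and $Q$ is the convex hull of $P\cup Q$ after embedding $P$ and $Q$ in skew affine subspaces (i.e. disjoint affine subspaces with no common direction); one has $\dim(P\star Q)=\dim P+\dim Q+1$. *)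

theory Defs
  imports
    "HOL-Analysis.Analysis"
    "HOL-Algebra.Sym_Groups"
    "HOL-Algebra.Generated_Groups"
    "HOL-Combinatorics.Cycles"
    "HOL-Number_Theory.Cong"
begin

text \<open>Permutations of \<open>{1..n}\<close> are functions \<open>nat \<Rightarrow> nat\<close>; the image \<open>(j)\<sigma>\<close> of the right
  action is written \<open>\<sigma> j\<close>. The group \<open>sym_group n\<close> multiplies from right to left, which does not
  affect the generated subset.\<close>

definition dihedral_rho :: "nat \<Rightarrow> nat \<Rightarrow> nat" where
  "dihedral_rho n = cycle_of_list [1..<n + 1]"

text \<open>\<open>(2,n)(3,n-1)\<cdots>(n/2,n/2+2)\<close>, for even \<open>n\<close>; the factors are disjoint.\<close>
definition dihedral_tau :: "nat \<Rightarrow> nat \<Rightarrow> nat" where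
  "dihedral_tau n = foldr (\<lambda>k p. Transposition.transpose k (n + 2 - k) \<circ> p) [2..<n div 2 + 1] id"

definition dihedral :: "nat \<Rightarrow> (nat \<Rightarrow> nat) set" where
  "dihedral n = generate (sym_group n) {dihedral_rho n, dihedral_tau n}"

text \<open>Matrices of a given size are indexed by a finite type, and an explicit bijection \<open>ix\<close> from
  that type onto \<open>{1..n}\<close> (for the permutation matrices) or \<open>{0..<m}\<close> (for \<open>Q\<^sub>m\<close>) numbers the
  rows and columns.\<close>

definition perm_matrix :: "('n::finite \<Rightarrow> nat) \<Rightarrow> (nat \<Rightarrow> nat) \<Rightarrow> real^'n^'n" where
  "perm_matrix ix \<sigma> = (\<chi> i j. if ix i = \<sigma> (ix j) then 1 else 0)"

definition DP_poly :: "nat \<Rightarrow> ('n::finite \<Rightarrow> nat) \<Rightarrow> (real^'n^'n) set" where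
  "DP_poly n ix = convex hull (perm_matrix ix ` dihedral n)"

definition shift_matrix :: "('m::finite \<Rightarrow> nat) \<Rightarrow> real^'m^'m" where
  "shift_matrix ix = (\<chi> i j. if [ix j = ix i + 1] (mod CARD('m)) then 1 else 0)"

text \<open>The operation \<open>(^)\<close> on \<open>real^'m^'m\<close> is the entrywise power, not the matrix power.\<close>
definition matrix_power :: "real^'m^'m \<Rightarrow> nat \<Rightarrow> real^'m^'m" where
  "matrix_power A k = (((**) A) ^^ k) (mat 1)"

text \<open>A point of \<open>\<real>\<^bsup>m\<^sup>2\<^esup>\<close> is an element of \<open>real^'m^'m\<close> whose \<open>k\<close>-th component is the part of
  the row lying in the \<open>k\<close>-th column block; block \<open>k\<close> of the lower half is \<open>R\<^sup>k\<close>, with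
  \<open>R\<^sup>0 = I\<close>.\<close>
definition Q_poly :: "('m::finite \<Rightarrow> nat) \<Rightarrow> (real^'m^'m) set" where
  "Q_poly ix = convex hull
     (range (\<lambda>i. \<chi> k. row i (mat 1)) \<union>
      range (\<lambda>i. \<chi> k. row i (matrix_power (shift_matrix ix) (ix k))))"

text \<open>Every affine map between affine hulls extends to the ambient spaces, where it has the form
  \<open>x \<mapsto> h x + c\<close> with \<open>h\<close> linear; only injectivity on the affine hull is required.\<close>
definition affinely_isomorphic :: "'a::euclidean_space set \<Rightarrow> 'b::euclidean_space set \<Rightarrow> bool" where
  "affinely_isomorphic S T \<longleftrightarrow>
     (\<exists>h c. linear h \<and> inj_on (\<lambda>x. h x + c) (affine hull S) \<and> (\<lambda>x. h x + c) ` S = T)"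

definition skew :: "'a::euclidean_space set \<Rightarrow> 'a set \<Rightarrow> bool" where
  "skew A B \<longleftrightarrow> A \<inter> B = {} \<and>
     (\<forall>a\<in>A. \<forall>a'\<in>A. \<forall>b\<in>B. \<forall>b'\<in>B. a - a' = b - b' \<longrightarrow> a - a' = 0)"

definition is_join ::
  "'a::euclidean_space set \<Rightarrow> 'b::euclidean_space set \<Rightarrow> 'c::euclidean_space set \<Rightarrow> bool" where
  "is_join P P' J \<longleftrightarrow>
     (\<exists>A B S T. affine A \<and> affine B \<and> skew A B \<and>
        S \<subseteq> A \<and> T \<subseteq> B \<and> affinely_isomorphic P S \<and> affinely_isomorphic P' T \<and>
        J = convex hull (S \<union> T))"

end

theory Submission
  imports Defs
begin

text \<open>Write \<open>n = 2m\<close> and read all indices modulo \<open>n\<close>. The elements of the dihedral group are the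
  rotations \<open>j \<mapsto> j + k\<close> and the reflections \<open>j \<mapsto> k - j\<close>, so the vertices of the permutation
  polytope are the matrices \<open>R\<^sub>k\<close> and \<open>S\<^sub>k\<close>, with ones exactly where \<open>i - j = k\<close>, respectively
  \<open>i + j = k\<close>. Because \<open>n\<close> is even, \<open>i - j\<close> and \<open>i + j\<close> have the same parity, so the matrices with
  even \<open>k\<close> and those with odd \<open>k\<close> have disjoint supports. This is what splits the polytope into a
  join: each parity class contributes one copy of \<open>Q\<^sub>m\<close>.

  To see the copy of \<open>Q\<^sub>m\<close> in the even class, put \<open>i - j = 2l\<close> and \<open>j = -k\<close>, so that
  \<open>i + j = 2(l - k)\<close>. As \<open>k\<close> and \<open>l\<close> run over the residues modulo \<open>m\<close>, the entry of \<open>R\<^sub>2\<^sub>u\<close> at this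
  place is one iff \<open>l = u\<close>, and that of \<open>S\<^sub>2\<^sub>v\<close> is one iff \<open>l = v + k\<close>: these are, in column \<open>l\<close> of
  block \<open>k\<close>, the rows of the two halves of the matrix that defines \<open>Q\<^sub>m\<close>. Adding one to \<open>i\<close> does
  the same for the odd class. A third coordinate that is zero on the even class and one on the odd
  class places the two copies in skew affine subspaces. The resulting linear map (\<open>join_map\<close>) looks
  at only half of the entries, those in the columns \<open>0, -1, ..., -(m-1)\<close>, but all vertices are
  unchanged when both indices move by \<open>m\<close>, and on the space of such matrices the map is injective
  (\<open>inj_on_join_map\<close>). Hence it restricts to an affine isomorphism of the polytope onto the join
  (\<open>join_map_DP\<close>, \<open>is_join_product\<close>).

  For the dimension, the only linear relations among the \<open>2n\<close> vertices are that, within each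
  parity class, the rotation matrices and the reflection matrices have the same sum. Leaving out
  \<open>S\<^sub>0\<close> and \<open>S\<^sub>1\<close> gives a basis of the linear span (\<open>independent_vertex_basis\<close>, \<open>vertices_in_span\<close>),
  which has dimension \<open>2n - 2\<close>; the affine hull misses the origin, since column sums are one, so
  its dimension is one less.\<close>

section \<open>The dihedral group as rotations and reflections\<close>

text \<open>Residues modulo \<open>n\<close> are represented by the vertex labels \<open>1, ..., n\<close>, so the residue \<open>0\<close>
  becomes \<open>n\<close>.\<close>
definition cyc :: "nat \<Rightarrow> int \<Rightarrow> nat" where
  "cyc n i = nat ((i - 1) mod int n) + 1"

text \<open>Outside \<open>{1..n}\<close> these functions are the identity, since they have to be elements of the
  symmetric group.\<close>
definition rotation :: "nat \<Rightarrow> int \<Rightarrow> nat \<Rightarrow> nat" where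
  "rotation n k j = (if j \<in> {1..n} then cyc n (int j + k) else j)"

definition reflection :: "nat \<Rightarrow> int \<Rightarrow> nat \<Rightarrow> nat" where
  "reflection n k j = (if j \<in> {1..n} then cyc n (k - int j) else j)"

lemma cyc_in: "n > 0 \<Longrightarrow> cyc n i \<in> {1..n}"
  by (simp add: cyc_def nat_less_iff Suc_le_eq)

lemma int_cyc: "n > 0 \<Longrightarrow> int (cyc n i) = (i - 1) mod int n + 1"
  by (simp add: cyc_def)

lemma dvd_cyc: "n > 0 \<Longrightarrow> int n dvd int (cyc n i) - i"
proof -
  assume "n > 0"
  then have "int (cyc n i) - i = - (int n * ((i - 1) div int n))"
    by (simp add: int_cyc minus_div_mult_eq_mod [symmetric])
  then show ?thesis by simp
qed

lemma cyc_eq_iff: "n > 0 \<Longrightarrow> cyc n i = cyc n j \<longleftrightarrow> int n dvd i - j"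
proof -
  assume n: "n > 0"
  have "cyc n i = cyc n j \<longleftrightarrow> int (cyc n i) = int (cyc n j)" by simp
  also have "\<dots> \<longleftrightarrow> (i - 1) mod int n = (j - 1) mod int n" by (simp only: int_cyc [OF n]) simp
  also have "\<dots> \<longleftrightarrow> int n dvd i - j" by (simp add: mod_eq_dvd_iff)
  finally show ?thesis .
qed

lemma cyc_of_nat: "j \<in> {1..n} \<Longrightarrow> cyc n (int j) = j"
  by (auto simp: cyc_def)

lemma cyc_cyc_add: "n > 0 \<Longrightarrow> cyc n (int (cyc n i) + a) = cyc n (i + a)"
  using dvd_cyc by (simp add: cyc_eq_iff)

lemma cyc_minus_cyc: "n > 0 \<Longrightarrow> cyc n (a - int (cyc n i)) = cyc n (a - i)"
  using dvd_cyc [of n i] by (simp add: cyc_eq_iff dvd_diff_commute)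

lemma rotation_reflection_comp:
  assumes "n > 0"
  shows "rotation n a \<circ> rotation n b = rotation n (a + b)"
    and "rotation n a \<circ> reflection n b = reflection n (a + b)"
    and "reflection n a \<circ> rotation n b = reflection n (a - b)"
    and "reflection n a \<circ> reflection n b = rotation n (a - b)"
proof -
  have add: "cyc n (c + int (cyc n i)) = cyc n (c + i)" for c i
    using cyc_cyc_add [OF assms, of i c] by (simp add: add.commute)
  show "rotation n a \<circ> rotation n b = rotation n (a + b)"
    "rotation n a \<circ> reflection n b = reflection n (a + b)"
    "reflection n a \<circ> rotation n b = reflection n (a - b)"
    "reflection n a \<circ> reflection n b = rotation n (a - b)"
    using cyc_in [OF assms]
    by (auto simp: fun_eq_iff rotation_def reflection_def add cyc_minus_cyc assms algebra_simps)
qed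

lemma rotation_0: "rotation n 0 = id"
  using cyc_of_nat by (auto simp: fun_eq_iff rotation_def)

lemma rotation_mod: "n > 0 \<Longrightarrow> rotation n (k mod int n) = rotation n k"
  by (auto simp: fun_eq_iff rotation_def cyc_eq_iff minus_mod_eq_mult_div [symmetric] mod_eq_dvd_iff [symmetric])

lemma permutes_of_inverse:
  assumes "p \<circ> q = id" "q \<circ> p = id" "\<And>x. x \<notin> S \<Longrightarrow> p x = x"
  shows "p permutes S"
  using o_bij [OF assms(2,1)] assms(3) unfolding permutes_def bij_iff by blast

lemma rotation_permutes: "n > 0 \<Longrightarrow> rotation n k permutes {1..n}"
  by (rule permutes_of_inverse [where q = "rotation n (- k)"])
     (auto simp: rotation_reflection_comp rotation_0, auto simp: rotation_def)

lemma reflection_permutes: "n > 0 \<Longrightarrow> reflection n k permutes {1..n}"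
  by (rule permutes_of_inverse [where q = "reflection n k"])
     (auto simp: rotation_reflection_comp rotation_0, auto simp: reflection_def)

lemma dihedral_rho_eq:
  assumes "n > 0"
  shows "dihedral_rho n = rotation n 1"
proof
  fix j
  show "dihedral_rho n j = rotation n 1 j"
  proof (cases "j \<in> {1..n}")
    case True
    have "map (cycle_of_list [1..<n+1] ^^ 1) [1..<n+1] = rotate 1 [1..<n+1]"
      by (rule cyclic_rotation) simp
    then have "map (cycle_of_list [1..<n+1]) [1..<n+1] ! (j - 1) = rotate 1 [1..<n+1] ! (j - 1)"
      by (simp only: One_nat_def funpow.simps o_id)
    moreover have "rotate 1 [1..<n+1] ! (j - 1) = [1..<n+1] ! ((1 + (j - 1)) mod length [1..<n+1])"
      using True by (intro nth_rotate) auto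
    moreover have "map (cycle_of_list [1..<n+1]) [1..<n+1] ! (j - 1) = cycle_of_list [1..<n+1] j"
      using True by (subst nth_map) (auto simp del: upt_Suc)
    moreover have index: "(1 + (j - 1)) mod length [1..<n+1] = j mod n"
      using True by simp
    ultimately have "cycle_of_list [1..<n+1] j = [1..<n+1] ! (j mod n)"
      by (simp only: index)
    also have "\<dots> = j mod n + 1" using assms by (simp del: upt_Suc)
    also have "\<dots> = cyc n (int j + 1)" by (simp add: cyc_def zmod_int [symmetric])
    finally show ?thesis using True by (simp add: dihedral_rho_def rotation_def)
  next
    case False
    have "dihedral_rho n j = j"
      unfolding dihedral_rho_def using False by (intro id_outside_supp) auto
    then show ?thesis using False by (metis rotation_def)
  qed
qed

text \<open>The factors move disjoint pairs: a label \<open>k\<close> with \<open>2 * k \<le> n\<close> lies strictly below its mirror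
  image \<open>n + 2 - k\<close>, so distinct such labels have no mirror images among each other and a point is
  moved by at most one factor.\<close>
lemma foldr_transpose_mirror:
  fixes ks :: "nat list"
  assumes "distinct ks" "\<forall>k\<in>set ks. 2 \<le> k \<and> 2 * k \<le> n"
  shows "foldr (\<lambda>k p. Transposition.transpose k (n + 2 - k) \<circ> p) ks id j =
    (if j \<in> set ks \<or> (j \<le> n \<and> n + 2 - j \<in> set ks) then n + 2 - j else j)"
  using assms
proof (induction ks)
  case (Cons a ks)
  then show ?case
    by (auto simp: Transposition.transpose_def split: if_splits)
qed simp

lemma dihedral_tau_eq:
  assumes "even n" "n > 0"
  shows "dihedral_tau n = reflection n 2"
proof
  fix j
  have *: "dihedral_tau n j =
     (if j \<in> {2..n div 2} \<or> (j \<le> n \<and> n + 2 - j \<in> {2..n div 2}) then n + 2 - j else j)"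
    unfolding dihedral_tau_def by (subst foldr_transpose_mirror) auto
  show "dihedral_tau n j = reflection n 2 j"
  proof (cases "j \<in> {1..n}")
    case True
    have "cyc n (2 - int j) = (if j = 1 then 1 else n + 2 - j)"
    proof (cases "j = 1")
      case False
      have "cyc n (2 - int j) = cyc n (int (n + 2 - j))"
        using assms True by (simp add: cyc_eq_iff of_nat_diff)
      also have "\<dots> = n + 2 - j" using False True by (intro cyc_of_nat) auto
      finally show ?thesis using False by simp
    qed (use assms cyc_of_nat [of 1 n] in auto)
    then show ?thesis using True assms unfolding * reflection_def by (auto elim!: evenE)
  qed (use assms in \<open>auto simp: * reflection_def\<close>)
qed

text \<open>Rotations and reflections are closed under composition and inversion, which gives one
  inclusion. Conversely, a rotation is a power of the rotation by one, with a nonnegative exponent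
  after reduction modulo \<open>n\<close>, and every reflection is a rotation after the given reflection
  \<open>j \<mapsto> 2 - j\<close>.\<close>
lemma dihedral_eq:
  assumes "even n" "n > 0"
  shows "dihedral n = range (rotation n) \<union> range (reflection n)"
proof -
  note comp = rotation_reflection_comp [OF assms(2)]
  have gens: "dihedral n = generate (sym_group n) {rotation n 1, reflection n 2}"
    using assms by (simp add: dihedral_def dihedral_rho_eq dihedral_tau_eq)
  have group: "group (sym_group n)" by (rule sym_group_is_group)
  have carr: "rotation n k \<in> carrier (sym_group n)" "reflection n k \<in> carrier (sym_group n)" for k
    using rotation_permutes [OF assms(2)] reflection_permutes [OF assms(2)]
    by (simp_all add: sym_group_carrier)
  have inv: "inv\<^bsub>sym_group n\<^esub> (rotation n 1) = rotation n (- 1)" "inv\<^bsub>sym_group n\<^esub> (reflection n 2) = reflection n 2"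
    by (rule group.inv_equality [OF group];
        simp add: carr sym_group_mult sym_group_one comp rotation_0)+
  have "\<sigma> \<in> range (rotation n) \<union> range (reflection n)"
    if "\<sigma> \<in> generate (sym_group n) {rotation n 1, reflection n 2}" for \<sigma>
    using that
  proof induction
    case one
    then show ?case by (metis UnI1 rangeI rotation_0 sym_group_one)
  next
    case (eng h1 h2)
    then show ?case by (elim UnE rangeE; simp add: sym_group_mult comp)
  qed (auto simp: inv)
  moreover have rot_gen: "rotation n k \<in> generate (sym_group n) {rotation n 1, reflection n 2}" for k
  proof -
    have "rotation n (int l) \<in> generate (sym_group n) {rotation n 1, reflection n 2}" for l
    proof (induction l)
      case 0
      then show ?case by (metis generate.one of_nat_0 rotation_0 sym_group_one)
    next
      case (Suc l)
      have "rotation n 1 \<otimes>\<^bsub>sym_group n\<^esub> rotation n (int l) \<in> generate (sym_group n) {rotation n 1, reflection n 2}"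
        by (rule generate.eng [OF _ Suc]) (simp add: generate.incl)
      then show ?case by (simp add: sym_group_mult comp)
    qed
    from this [of "nat (k mod int n)"] show ?thesis using assms by (simp add: rotation_mod)
  qed
  moreover have "reflection n k \<in> generate (sym_group n) {rotation n 1, reflection n 2}" for k
  proof -
    have "rotation n (k - 2) \<otimes>\<^bsub>sym_group n\<^esub> reflection n 2 \<in> generate (sym_group n) {rotation n 1, reflection n 2}"
      by (rule generate.eng [OF rot_gen]) (simp add: generate.incl)
    then show ?thesis by (simp add: sym_group_mult comp)
  qed
  ultimately show ?thesis unfolding gens by blast
qed

section \<open>Permutation matrices of the dihedral group\<close>

lemma dvd_diff_imp_iff: "d dvd a - b \<Longrightarrow> d dvd a \<longleftrightarrow> d dvd (b::int)"
  by (metis diff_add_cancel dvd_add_right_iff)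

definition rot_matrix :: "nat \<Rightarrow> ('n::finite \<Rightarrow> nat) \<Rightarrow> int \<Rightarrow> real^'n^'n" where
  "rot_matrix n ix k = (\<chi> i j. of_bool (int n dvd int (ix i) - int (ix j) - k))"

definition refl_matrix :: "nat \<Rightarrow> ('n::finite \<Rightarrow> nat) \<Rightarrow> int \<Rightarrow> real^'n^'n" where
  "refl_matrix n ix k = (\<chi> i j. of_bool (int n dvd int (ix i) + int (ix j) - k))"

locale cyclic_index =
  fixes n :: nat and ix :: "'n::finite \<Rightarrow> nat"
  assumes bij: "bij_betw ix UNIV {1..n}"
begin

text \<open>Row and column numbers may be arbitrary integers, read modulo \<open>n\<close>. This avoids
  every case distinction on wrap-around.\<close>
definition idx :: "int \<Rightarrow> 'n" where
  "idx i = inv_into UNIV ix (cyc n i)"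

lemma ix_in: "ix i \<in> {1..n}"
  using bij by (auto simp: bij_betw_def)

lemma n_pos: "n > 0"
  using ix_in by fastforce

lemma ix_idx: "ix (idx i) = cyc n i"
  unfolding idx_def by (metis bij bij_betw_inv_into_right cyc_in n_pos)

lemma idx_ix: "idx (int (ix i)) = i"
  using bij unfolding idx_def by (simp only: cyc_of_nat [OF ix_in] bij_betw_def inv_into_f_f UNIV_I)

lemma idx_eq_iff: "idx i = idx j \<longleftrightarrow> int n dvd i - j"
  by (metis cyc_eq_iff ix_idx idx_def n_pos)

lemma dvd_ix_idx: "int n dvd int (ix (idx i)) - i"
  by (simp add: ix_idx dvd_cyc n_pos)

lemma perm_matrix_rotation: "perm_matrix ix (rotation n k) = rot_matrix n ix k"
proof -
  have "ix i = rotation n k (ix j) \<longleftrightarrow> int n dvd int (ix i) - int (ix j) - k" for i j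
  proof -
    have "ix i = rotation n k (ix j) \<longleftrightarrow> cyc n (int (ix i)) = cyc n (int (ix j) + k)"
      using ix_in [of j] by (simp only: rotation_def cyc_of_nat [OF ix_in] if_True)
    then show ?thesis by (simp add: cyc_eq_iff n_pos diff_diff_eq)
  qed
  then show ?thesis by (simp add: perm_matrix_def rot_matrix_def vec_eq_iff)
qed

lemma perm_matrix_reflection: "perm_matrix ix (reflection n k) = refl_matrix n ix k"
proof -
  have "ix i = reflection n k (ix j) \<longleftrightarrow> int n dvd int (ix i) + int (ix j) - k" for i j
  proof -
    have "ix i = reflection n k (ix j) \<longleftrightarrow> cyc n (int (ix i)) = cyc n (k - int (ix j))"
      using ix_in [of j] by (simp only: reflection_def cyc_of_nat [OF ix_in] if_True)
    then show ?thesis by (simp add: cyc_eq_iff n_pos diff_diff_eq2)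
  qed
  then show ?thesis by (simp add: perm_matrix_def refl_matrix_def vec_eq_iff)
qed

lemma DP_poly_eq:
  assumes "even n"
  shows "DP_poly n ix = convex hull (range (rot_matrix n ix) \<union> range (refl_matrix n ix))"
  using assms n_pos
  by (simp add: DP_poly_def dihedral_eq image_Un image_image perm_matrix_rotation perm_matrix_reflection)

lemma rot_matrix_idx: "rot_matrix n ix k $ idx i $ idx j = of_bool (int n dvd i - j - k)"
proof -
  have "int n dvd (int (ix (idx i)) - i) - (int (ix (idx j)) - j)"
    by (intro dvd_diff dvd_ix_idx)
  then have "int n dvd (int (ix (idx i)) - int (ix (idx j)) - k) - (i - j - k)"
    by (simp add: algebra_simps)
  from dvd_diff_imp_iff [OF this] show ?thesis by (simp add: rot_matrix_def)
qed

lemma refl_matrix_idx: "refl_matrix n ix k $ idx i $ idx j = of_bool (int n dvd i + j - k)"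
proof -
  have "int n dvd (int (ix (idx i)) - i) + (int (ix (idx j)) - j)"
    by (intro dvd_add dvd_ix_idx)
  then have "int n dvd (int (ix (idx i)) + int (ix (idx j)) - k) - (i + j - k)"
    by (simp add: algebra_simps)
  from dvd_diff_imp_iff [OF this] show ?thesis by (simp add: refl_matrix_def)
qed

lemma matrix_eq_iff_idx:
  fixes M M' :: "real^'n^'n"
  shows "M = M' \<longleftrightarrow> (\<forall>i j. M $ idx i $ idx j = M' $ idx i $ idx j)"
  by (metis idx_ix vec_eq_iff)

lemma column_sum_vertex:
  assumes "M \<in> range (rot_matrix n ix) \<union> range (refl_matrix n ix)"
  shows "(\<Sum>i\<in>UNIV. M $ i $ idx 0) = 1"
proof -
  have "rot_matrix n ix k $ i $ idx 0 = of_bool (i = idx k)"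
    "refl_matrix n ix k $ i $ idx 0 = of_bool (i = idx k)" for k i
    using rot_matrix_idx [of k "int (ix i)" 0] refl_matrix_idx [of k "int (ix i)" 0]
      idx_eq_iff [of "int (ix i)" k]
    by (simp_all add: idx_ix)
  then show ?thesis using assms by auto
qed

end

section \<open>The vertices of the polytope Q\<close>

locale residue_index =
  fixes m :: nat and iy :: "'m::finite \<Rightarrow> nat"
  assumes bij_iy: "bij_betw iy UNIV {0..<m}"
begin

text \<open>The counterpart of \<open>idx\<close> for labels that start at zero.\<close>
definition jdx :: "int \<Rightarrow> 'm" where
  "jdx i = inv_into UNIV iy (nat (i mod int m))"

lemma card_m: "CARD('m) = m"
  using bij_betw_same_card [OF bij_iy] by simp

lemma m_pos: "m > 0"
  using card_m zero_less_card_finite by metis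

lemma iy_less: "iy i < m"
  using bij_iy by (auto simp: bij_betw_def)

lemma iy_jdx: "int (iy (jdx i)) = i mod int m"
proof -
  have "nat (i mod int m) \<in> {0..<m}" using m_pos by (simp add: nat_less_iff)
  then have "iy (jdx i) = nat (i mod int m)"
    unfolding jdx_def by (metis bij_iy bij_betw_inv_into_right)
  then show ?thesis using m_pos by simp
qed

lemma jdx_iy: "jdx (int (iy l)) = l"
  using bij_iy iy_less [of l] by (simp add: jdx_def bij_betw_def)

lemma jdx_eq_iff: "l = jdx u \<longleftrightarrow> int m dvd int (iy l) - u"
proof -
  have "l = jdx u \<longleftrightarrow> int (iy l) = u mod int m"
    by (metis iy_jdx jdx_iy)
  also have "\<dots> \<longleftrightarrow> int (iy l) mod int m = u mod int m" using iy_less [of l] by simp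
  finally show ?thesis by (simp add: mod_eq_dvd_iff)
qed

lemma dvd_iy_jdx: "int m dvd int (iy (jdx u)) - u"
  using jdx_eq_iff by blast

text \<open>The rows of the upper and of the lower half of the matrix defining \<open>Q\<^sub>m\<close>, with the row number
  extended periodically to all integers: in the upper half all blocks are equal, in the lower
  half block \<open>k\<close> is shifted by \<open>k\<close>.\<close>
definition Q_const :: "int \<Rightarrow> real^'m^'m" where
  "Q_const u = (\<chi> k l. of_bool (int m dvd int (iy l) - u))"

definition Q_shift :: "int \<Rightarrow> real^'m^'m" where
  "Q_shift v = (\<chi> k l. of_bool (int m dvd int (iy l) - int (iy k) - v))"

lemma Q_periodic:
  assumes "int m dvd u - v"
  shows "Q_const u = Q_const v" "Q_shift u = Q_shift v"
proof -
  have "int m dvd (a - u) - (a - v)" for a using assms by (simp add: dvd_diff_commute)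
  from dvd_diff_imp_iff [OF this] show "Q_const u = Q_const v" "Q_shift u = Q_shift v"
    by (simp_all add: Q_const_def Q_shift_def)
qed

text \<open>Row \<open>i\<close> of the product of the shift matrix with \<open>P\<close> is row \<open>i + 1\<close> of \<open>P\<close>, so each factor
  shifts the ones by one more column.\<close>
lemma matrix_power_shift:
  "matrix_power (shift_matrix iy) k $ i $ j = of_bool (int m dvd int (iy j) - int (iy i) - int k)"
proof (induction k arbitrary: i)
  case 0
  show ?case
    using jdx_eq_iff [of j "int (iy i)"] by (auto simp: matrix_power_def mat_def jdx_iy)
next
  case (Suc k)
  have shift: "shift_matrix iy $ i $ l = of_bool (l = jdx (int (iy i) + 1))" for l
  proof -
    have "[iy l = iy i + 1] (mod m) \<longleftrightarrow> [int (iy l) = int (iy i) + 1] (mod int m)"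
      by (simp add: cong_int_iff [symmetric] add.commute)
    then show ?thesis by (simp add: shift_matrix_def card_m jdx_eq_iff cong_iff_dvd_diff)
  qed
  let ?l = "jdx (int (iy i) + 1)"
  have "matrix_power (shift_matrix iy) (Suc k) $ i $ j
      = (\<Sum>l\<in>UNIV. shift_matrix iy $ i $ l * matrix_power (shift_matrix iy) k $ l $ j)"
    by (simp add: matrix_power_def matrix_matrix_mult_def)
  also have "\<dots> = of_bool (int m dvd int (iy j) - int (iy ?l) - int k)"
    by (simp add: shift Suc.IH)
  also have "int m dvd int (iy j) - int (iy ?l) - int k
      \<longleftrightarrow> int m dvd int (iy j) - int (iy i) - int (Suc k)"
  proof (rule dvd_diff_imp_iff)
    have "int m dvd - (int (iy ?l) - (int (iy i) + 1))" by (simp only: dvd_minus_iff dvd_iy_jdx)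
    then show "int m dvd int (iy j) - int (iy ?l) - int k - (int (iy j) - int (iy i) - int (Suc k))"
      by (simp add: algebra_simps)
  qed
  finally show ?case .
qed

lemma Q_poly_eq: "Q_poly iy = convex hull (range Q_const \<union> range Q_shift)"
proof -
  have const: "(\<chi> k. row i (mat 1)) = Q_const (int (iy i))" for i
  proof -
    have "i = l \<longleftrightarrow> int m dvd int (iy l) - int (iy i)" for l
      by (metis jdx_eq_iff jdx_iy)
    then show ?thesis by (simp add: Q_const_def row_def mat_def vec_eq_iff)
  qed
  have shift: "(\<chi> k. row i (matrix_power (shift_matrix iy) (iy k))) = Q_shift (int (iy i))" for i
    by (simp add: Q_shift_def row_def vec_eq_iff matrix_power_shift algebra_simps)
  have "range (\<lambda>i. f (int (iy i))) = range f" if "\<And>u v. int m dvd u - v \<Longrightarrow> f u = f v"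
    for f :: "int \<Rightarrow> real^'m^'m"
    using that [OF dvd_iy_jdx] by (metis (mono_tags, lifting) image_eqI rangeE rangeI subsetI subset_antisym)
  from this [of Q_const] this [of Q_shift] show ?thesis
    by (simp add: Q_poly_def const shift Q_periodic)
qed

lemma sum_residue: "(\<Sum>l\<in>UNIV. of_bool (int m dvd int (iy l) - u)) = (1::real)"
  by (simp flip: jdx_eq_iff)

end

section \<open>The linear map onto the join\<close>

lemma double_dvd_iff: "x = 2 * y \<Longrightarrow> int (2 * m) dvd x \<longleftrightarrow> int m dvd y"
  by simp

lemma double_not_dvd_odd: "odd x \<Longrightarrow> \<not> int (2 * m) dvd x"
  by (metis dvd_trans dvd_triv_left int_ops(7) of_nat_numeral)

lemma range_even_odd: "range f = range (\<lambda>u. f (2 * u)) \<union> range (\<lambda>u. f (2 * u + 1 :: int))"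
  by (auto simp: image_iff) (metis evenE oddE)

locale dihedral_join =
  cyclic_index "2 * m" ix + residue_index m iy
  for m :: nat and ix :: "'n::finite \<Rightarrow> nat" and iy :: "'m::finite \<Rightarrow> nat"
begin

abbreviation R :: "int \<Rightarrow> real^'n^'n" where "R \<equiv> rot_matrix (2 * m) ix"
abbreviation S :: "int \<Rightarrow> real^'n^'n" where "S \<equiv> refl_matrix (2 * m) ix"

text \<open>The even and the odd diagonals in the columns \<open>-k\<close>, arranged so that the difference of the
  row and column numbers depends on \<open>l\<close> only. The third component sums column \<open>0\<close> over the rows
  with odd number; every vertex has a single one in that column, in row \<open>k\<close> for \<open>R\<^sub>k\<close> and \<open>S\<^sub>k\<close>, so
  the sum is the parity of \<open>k\<close>.\<close>
definition join_map :: "real^'n^'n \<Rightarrow> (real^'m^'m) \<times> (real^'m^'m) \<times> real" where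
  "join_map M =
    ((\<chi> k l. M $ idx (2 * int (iy l) - int (iy k)) $ idx (- int (iy k))),
     (\<chi> k l. M $ idx (2 * int (iy l) - int (iy k) + 1) $ idx (- int (iy k))),
     (\<Sum>l\<in>UNIV. M $ idx (2 * int (iy l) + 1) $ idx 0))"

lemma linear_join_map: "linear join_map"
  by (rule linearI)
     (auto simp: join_map_def vec_eq_iff sum.distrib sum_distrib_left)

text \<open>At the entry with row \<open>2l - k + e\<close> and column \<open>-k\<close>, the difference is \<open>2l + e\<close> and the sum is
  \<open>2(l - k) + e\<close>. Comparing with an index of the same parity divides the congruence modulo \<open>2m\<close>
  by two; an index of the other parity never fits.\<close>
lemma join_map_vertices:
  "join_map (R (2 * u)) = (Q_const u, 0, 0)"
  "join_map (R (2 * u + 1)) = (0, Q_const u, 1)"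
  "join_map (S (2 * v)) = (Q_shift v, 0, 0)"
  "join_map (S (2 * v + 1)) = (0, Q_shift v, 1)"
proof -
  note simps = join_map_def rot_matrix_idx refl_matrix_idx Q_const_def Q_shift_def
    prod_eq_iff vec_eq_iff
  have sum: "(\<Sum>l\<in>UNIV. of_bool (int (2 * m) dvd 2 * int (iy l) + 1 - (2 * u + 1))) = (1::real)" for u
  proof -
    have "int (2 * m) dvd 2 * int (iy l) + 1 - (2 * u + 1) \<longleftrightarrow> int m dvd int (iy l) - u" for l
      by (rule double_dvd_iff) simp
    then show ?thesis by (simp only: sum_residue)
  qed
  have R0: "int (2 * m) dvd 2 * l - k - (- k) - 2 * u \<longleftrightarrow> int m dvd l - u" for l k u :: int
    by (rule double_dvd_iff) simp
  have R1: "int (2 * m) dvd 2 * l - k + 1 - (- k) - (2 * u + 1) \<longleftrightarrow> int m dvd l - u" for l k u :: int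
    by (rule double_dvd_iff) simp
  have S0: "int (2 * m) dvd 2 * l - k + (- k) - 2 * v \<longleftrightarrow> int m dvd l - k - v" for l k v :: int
    by (rule double_dvd_iff) simp
  have S1: "int (2 * m) dvd 2 * l - k + 1 + (- k) - (2 * v + 1) \<longleftrightarrow> int m dvd l - k - v" for l k v :: int
    by (rule double_dvd_iff) simp
  have odd: "\<not> int (2 * m) dvd 2 * l - k + 1 - (- k) - 2 * u"
    "\<not> int (2 * m) dvd 2 * l - k - (- k) - (2 * u + 1)"
    "\<not> int (2 * m) dvd 2 * l - k + 1 + (- k) - 2 * u"
    "\<not> int (2 * m) dvd 2 * l - k + (- k) - (2 * u + 1)"
    "\<not> int (2 * m) dvd 2 * l + 1 - 2 * u" for l k u :: int
    by (rule double_not_dvd_odd; simp)+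
  note simps' = simps R0 R1 S0 S1 odd sum vec_lambda_beta fst_conv snd_conv zero_index of_bool_eq
    sum.neutral_const diff_zero add_0_right simp_thms
  show "join_map (R (2 * u)) = (Q_const u, 0, 0)" by (simp only: simps')
  show "join_map (R (2 * u + 1)) = (0, Q_const u, 1)" by (simp only: simps')
  show "join_map (S (2 * v)) = (Q_shift v, 0, 0)" by (simp only: simps')
  show "join_map (S (2 * v + 1)) = (0, Q_shift v, 1)" by (simp only: simps')
qed

text \<open>These are the matrices that commute with the half turn \<open>R\<^sub>m\<close>. The half turn is central in
  the dihedral group, so all vertices have this property.\<close>
definition half_turn_invariant :: "(real^'n^'n) set" where
  "half_turn_invariant = {M. \<forall>i j. M $ idx (i + int m) $ idx (j + int m) = M $ idx i $ idx j}"

lemma vertices_half_turn_invariant: "range R \<union> range S \<subseteq> half_turn_invariant"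
proof -
  have "R k \<in> half_turn_invariant" for k
    by (simp only: half_turn_invariant_def mem_Collect_eq rot_matrix_idx) simp
  moreover have "S k \<in> half_turn_invariant" for k
  proof -
    have "int (2 * m) dvd i + int m + (j + int m) - k \<longleftrightarrow> int (2 * m) dvd i + j - k" for i j
      by (rule dvd_diff_imp_iff) simp
    then show ?thesis
      by (simp only: half_turn_invariant_def mem_Collect_eq refl_matrix_idx) simp
  qed
  ultimately show ?thesis by blast
qed

lemma affine_half_turn_invariant: "affine half_turn_invariant"
  by (simp add: affine_def half_turn_invariant_def)

text \<open>Every row number has one of the forms \<open>2l - k\<close> and \<open>2l - k + 1\<close>, so the map determines all
  entries in the columns \<open>-k\<close> with \<open>0 \<le> k < m\<close>; half-turn invariance gives the other columns.\<close>
lemma inj_on_join_map: "inj_on join_map half_turn_invariant"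
proof (rule inj_onI)
  fix M M'
  assume M: "M \<in> half_turn_invariant" and M': "M' \<in> half_turn_invariant" and eq: "join_map M = join_map M'"
  have even: "M $ idx (2 * int (iy l) - int (iy k)) $ idx (- int (iy k))
      = M' $ idx (2 * int (iy l) - int (iy k)) $ idx (- int (iy k))"
    and odd: "M $ idx (2 * int (iy l) - int (iy k) + 1) $ idx (- int (iy k))
      = M' $ idx (2 * int (iy l) - int (iy k) + 1) $ idx (- int (iy k))" for k l
    using eq by (simp_all add: join_map_def vec_eq_iff)
  have half: "M $ idx i $ idx (- k) = M' $ idx i $ idx (- k)" if "0 \<le> k" "k < int m" for i k
  proof -
    have k: "int (iy (jdx k)) = k" using that by (simp add: iy_jdx)
    \<comment> \<open>The solution of \<open>i = 2l - k + e\<close> modulo \<open>2m\<close>, where \<open>e\<close> selects the component of the map.\<close>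
    define e where "e = (i + k) mod 2"
    define l where "l = jdx ((i + k) div 2)"
    have dvd: "int m dvd int (iy l) - (i + k) div 2" unfolding l_def by (rule dvd_iy_jdx)
    have "2 * int (iy l) - k + e - i = 2 * (int (iy l) - (i + k) div 2)"
      unfolding e_def right_diff_distrib minus_mod_eq_mult_div [symmetric] by simp
    from double_dvd_iff [OF this] dvd have "int (2 * m) dvd 2 * int (iy l) - k + e - i"
      by (rule iffD2)
    then have i: "idx i = idx (2 * int (iy l) - k + e)" by (metis idx_eq_iff)
    have "e = 0 \<or> e = 1" by (auto simp: e_def)
    then show ?thesis
      using even [of l "jdx k"] odd [of l "jdx k"] unfolding i k by auto
  qed
  have "M $ idx i $ idx j = M' $ idx i $ idx j" for i j
  proof -
    define t where "t = (- j) mod int (2 * m)"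
    have t: "0 \<le> t" "t < 2 * int m" using m_pos by (simp_all add: t_def)
    have "- j - t = int (2 * m) * ((- j) div int (2 * m))"
      unfolding t_def by (rule minus_mod_eq_mult_div)
    then have "j - (- t) = int (2 * m) * - ((- j) div int (2 * m))" by linarith
    then have "int (2 * m) dvd j - (- t)" by (rule dvdI)
    then have j: "idx j = idx (- t)" by (metis idx_eq_iff)
    show ?thesis
    proof (cases "t < int m")
      case True
      then show ?thesis using half t j by simp
    next
      case False
      \<comment> \<open>Both indices move by \<open>m\<close>, which brings the column \<open>-t\<close> into the half already known.\<close>
      have "X $ idx i $ idx j = X $ idx (i + int m) $ idx (- (t - int m))" if "X \<in> half_turn_invariant" for X
      proof -
        have "- (t - int m) = - t + int m" by simp
        then show ?thesis using that by (simp only: half_turn_invariant_def mem_Collect_eq j)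
      qed
      then show ?thesis using half [of "t - int m"] t False M M' by simp
    qed
  qed
  then show "M = M'" by (simp add: matrix_eq_iff_idx)
qed

lemma affinely_isomorphic_join_map:
  "affinely_isomorphic (DP_poly (2 * m) ix) (join_map ` DP_poly (2 * m) ix)"
proof -
  have "affine hull DP_poly (2 * m) ix \<subseteq> half_turn_invariant"
    using vertices_half_turn_invariant affine_half_turn_invariant
    by (simp add: DP_poly_eq affine_hull_convex_hull hull_minimal)
  then show ?thesis
    unfolding affinely_isomorphic_def
    using linear_join_map inj_on_subset [OF inj_on_join_map]
    by (intro exI [where x = join_map] exI [where x = 0]) auto
qed

lemma join_map_DP:
  "join_map ` DP_poly (2 * m) ix = convex hull (Q_poly iy \<times> {0} \<times> {0} \<union> {0} \<times> Q_poly iy \<times> {1})"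
proof -
  let ?G = "range Q_const \<union> range Q_shift"
  have "join_map ` (range R \<union> range S) = ?G \<times> {0} \<times> {0} \<union> {0} \<times> ?G \<times> {1}"
    unfolding range_even_odd [of R] range_even_odd [of S]
    by (simp add: image_Un image_image join_map_vertices) auto
  then have "join_map ` DP_poly (2 * m) ix = convex hull (?G \<times> {0} \<times> {0} \<union> {0} \<times> ?G \<times> {1})"
    by (simp add: DP_poly_eq convex_hull_linear_image [OF linear_join_map])
  also have "\<dots> = convex hull (convex hull (?G \<times> {0} \<times> {0}) \<union> convex hull ({0} \<times> ?G \<times> {1}))"
    by (rule hull_Un) (rule convex_Inter, blast)
  finally show ?thesis
    by (simp only: convex_hull_Times convex_hull_singleton Q_poly_eq)
qed

end

text \<open>The standard model of a join: the third coordinate separates the two affine subspaces, and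
  their directions lie in different factors of the product.\<close>
lemma is_join_product:
  fixes P :: "'a::euclidean_space set" and P' :: "'b::euclidean_space set"
  shows "is_join P P' (convex hull (P \<times> {0} \<times> {0} \<union> {0} \<times> P' \<times> {1 :: real}))"
  unfolding is_join_def
proof (intro exI conjI)
  show "affine (UNIV \<times> {0} \<times> {0} :: ('a \<times> 'b \<times> real) set)"
    "affine ({0} \<times> UNIV \<times> {1} :: ('a \<times> 'b \<times> real) set)"
    by (simp_all add: affine_def mem_Times_iff)
  show "skew (UNIV \<times> {0} \<times> {0} :: ('a \<times> 'b \<times> real) set) ({0} \<times> UNIV \<times> {1})"
    by (auto simp: skew_def zero_prod_def)
  have "linear (\<lambda>x::'a. (x, 0::'b, 0::real))" "linear (\<lambda>x::'b. (0::'a, x, 0::real))"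
    by (auto intro!: linearI)
  then show "affinely_isomorphic P (P \<times> {0} \<times> {0} :: ('a \<times> 'b \<times> real) set)"
    "affinely_isomorphic P' ({0} \<times> P' \<times> {1} :: ('a \<times> 'b \<times> real) set)"
    unfolding affinely_isomorphic_def
    by (intro exI [where x = "\<lambda>x. (x, 0, 0)"] exI [where x = 0]
              exI [where x = "\<lambda>x. (0, x, 0)"] exI [where x = "(0, 0, 1)"];
        auto simp: inj_on_def)+
qed auto

section \<open>The dimension\<close>

text \<open>Adding the origin to a set whose affine hull misses it raises the affine dimension by one
  and makes it equal to the linear dimension.\<close>
lemma aff_dim_of_dim:
  fixes V :: "'a::euclidean_space set"
  assumes "0 \<notin> affine hull V"
  shows "aff_dim V = int (dim V) - 1"
  using aff_dim_insert [of 0 V] aff_dim_zero [of "insert 0 V"] assms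
  by (simp add: hull_inc dim_insert span_zero)

text \<open>The doubled residues \<open>2u\<close> modulo \<open>2m\<close> hit every even number exactly once. This is the
  reason why the sum of the \<open>R\<^sub>2\<^sub>u\<close> and the sum of the \<open>S\<^sub>2\<^sub>v\<close> agree: both have ones at all places where
  \<open>i - j\<close>, equivalently \<open>i + j\<close>, is even.\<close>
lemma sum_even_residues:
  "(\<Sum>u\<in>{0..<int m}. of_bool (int (2 * m) dvd x - 2 * u)) = (of_bool (m > 0 \<and> even x) :: real)"
proof (cases "m > 0 \<and> even x")
  case True
  then obtain y where x: "x = 2 * y" by auto
  have "int (2 * m) dvd x - 2 * u \<longleftrightarrow> u = y mod int m" if "u \<in> {0..<int m}" for u
  proof -
    have "int (2 * m) dvd x - 2 * u \<longleftrightarrow> int m dvd y - u"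
      by (rule double_dvd_iff) (simp add: x)
    then show ?thesis using that by (auto simp flip: mod_eq_dvd_iff)
  qed
  then have "(\<Sum>u\<in>{0..<int m}. of_bool (int (2 * m) dvd x - 2 * u))
      = (\<Sum>u\<in>{0..<int m}. of_bool (u = y mod int m) :: real)"
    by (intro sum.cong) auto
  then show ?thesis using True by simp
next
  case False
  then have "m = 0 \<or> odd x" by auto
  then show ?thesis
  proof
    assume "odd x"
    then have "\<not> int (2 * m) dvd x - 2 * u" for u by (intro double_not_dvd_odd) simp
    then show ?thesis using \<open>odd x\<close> by simp
  qed simp
qed

lemma dvd_diff_iff_eq: 
  "a \<in> {0..<n} \<Longrightarrow> b \<in> {0..<n} \<Longrightarrow> n dvd a - b \<longleftrightarrow> a = (b::int)"
  by (simp flip: mod_eq_dvd_iff)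

context dihedral_join
begin

definition vertex_basis :: "(real^'n^'n) set" where
  "vertex_basis = R ` {0..<2 * int m} \<union> S ` {2..<2 * int m}"

text \<open>A rotation matrix differs from a reflection matrix because \<open>i + j\<close> changes by two along a
  diagonal \<open>i - j = k\<close>, and two is not zero modulo \<open>2m\<close> when \<open>m \<ge> 2\<close>.\<close>
lemma vertices_distinct:
  assumes "m \<ge> 2"
  shows "inj_on R {0..<2 * int m}" "inj_on S {2..<2 * int m}" "R k \<noteq> S l"
proof -
  have dvd: "int (2 * m) dvd k - l" if "of_bool (int (2 * m) dvd k - k) = (of_bool (int (2 * m) dvd k - l) :: real)"
    for k l
    using that by (simp only: diff_self dvd_0_right of_bool_eq_iff simp_thms)
  have R: "int (2 * m) dvd k - l" if "R k = R l" for k l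
    using rot_matrix_idx [of k k 0] rot_matrix_idx [of l k 0] that by (intro dvd) (simp only: diff_zero)
  have S: "int (2 * m) dvd k - l" if "S k = S l" for k l
    using refl_matrix_idx [of k k 0] refl_matrix_idx [of l k 0] that by (intro dvd) (simp only: add_0_right)
  have eq: "k = l" if "int (2 * m) dvd k - l" "k \<in> {0..<2 * int m}" "l \<in> {0..<2 * int m}" for k l
    using that dvd_diff_iff_eq [of k "int (2 * m)" l] by simp
  show "inj_on R {0..<2 * int m}"
    by (intro inj_onI) (rule eq [OF R])
  show "inj_on S {2..<2 * int m}"
    by (intro inj_onI) (rule eq [OF S], simp_all)
  show "R k \<noteq> S l"
  proof
    assume eq: "R k = S l"
    have "int (2 * m) dvd (k + 1 + 1 - l) - (k + 0 - l)"
    proof (rule dvd_diff)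
      have "R k $ idx (k + 1) $ idx 1 = 1" by (simp only: rot_matrix_idx) simp
      then show "int (2 * m) dvd k + 1 + 1 - l"
        by (simp only: eq refl_matrix_idx of_bool_eq_1_iff)
      have "R k $ idx k $ idx 0 = 1" by (simp only: rot_matrix_idx) simp
      then show "int (2 * m) dvd k + 0 - l"
        by (simp only: eq refl_matrix_idx of_bool_eq_1_iff)
    qed
    moreover have "k + 1 + 1 - l - (k + 0 - l) = 2" by simp
    ultimately have "int (2 * m) dvd 2" by (simp only:)
    then have "int (2 * m) \<le> 2" by (rule zdvd_imp_le) simp
    then show False using assms by simp
  qed
qed

lemma sum_vertex_basis:
  assumes "m \<ge> 2"
  shows "(\<Sum>v\<in>vertex_basis. c v *\<^sub>R v) $ idx i $ idx j =
    (\<Sum>k\<in>{0..<2 * int m}. c (R k) * of_bool (int (2 * m) dvd i - j - k)) +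
    (\<Sum>k\<in>{2..<2 * int m}. c (S k) * of_bool (int (2 * m) dvd i + j - k))"
proof -
  have "(\<Sum>v\<in>vertex_basis. c v *\<^sub>R v)
      = (\<Sum>k\<in>{0..<2 * int m}. c (R k) *\<^sub>R R k) + (\<Sum>k\<in>{2..<2 * int m}. c (S k) *\<^sub>R S k)"
    unfolding vertex_basis_def
    using vertices_distinct [OF assms]
    by (subst sum.union_disjoint) (auto simp: sum.reindex)
  then show ?thesis
    by (simp only: vector_add_component sum_component vector_scaleR_component real_scaleR_def rot_matrix_idx refl_matrix_idx)
qed

text \<open>The entry at \<open>(i, j)\<close> of a vanishing combination says that the coefficients of \<open>R\<close> at
  \<open>i - j\<close> and of \<open>S\<close> at \<open>i + j\<close> add up to zero. The sum \<open>i + j\<close> can be chosen to be \<open>0\<close> or \<open>1\<close>,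
  where no reflection matrix is present, for either parity of \<open>i - j\<close>; so all coefficients of
  rotations vanish, and then those of reflections do too.\<close>
lemma independent_vertex_basis:
  assumes "m \<ge> 2"
  shows "independent vertex_basis"
proof -
  have finite: "finite vertex_basis" by (simp add: vertex_basis_def)
  have "c v = 0" if zero: "(\<Sum>v\<in>vertex_basis. c v *\<^sub>R v) = 0" and v: "v \<in> vertex_basis"
    for c v
  proof -
    have entry: "(\<Sum>k\<in>{0..<2 * int m}. c (R k) * of_bool (int (2 * m) dvd i - j - k)) +
      (\<Sum>k\<in>{2..<2 * int m}. c (S k) * of_bool (int (2 * m) dvd i + j - k)) = 0" for i j
      unfolding sum_vertex_basis [OF assms, symmetric] zero by simp
    have eq: "int (2 * m) dvd a - b \<longleftrightarrow> b = a"
      if "a \<in> {0..<2 * int m}" "b \<in> {0..<2 * int m}" for a b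
      using that by (subst dvd_diff_iff_eq) auto
    have R0: "c (R d) = 0" if d: "d \<in> {0..<2 * int m}" for d
    proof -
      \<comment> \<open>The row \<open>d + j\<close> and column \<open>j\<close> have difference \<open>d\<close> and sum \<open>e\<close>.\<close>
      define e where "e = d mod 2"
      define j where "j = - (d div 2)"
      have "e \<in> {0..<2}" by (simp add: e_def)
      have ij: "(d + j) - j = d" "(d + j) + j = e"
        by (auto simp: e_def j_def minus_mod_eq_mult_div [symmetric])
      have "(\<Sum>k\<in>{0..<2 * int m}. c (R k) * of_bool (int (2 * m) dvd d - k))
          = (\<Sum>k\<in>{0..<2 * int m}. c (R k) * of_bool (k = d))"
        using d by (intro sum.cong refl) (simp only: eq)
      moreover have "(\<Sum>k\<in>{2..<2 * int m}. c (S k) * of_bool (int (2 * m) dvd e - k)) = 0"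
      proof (intro sum.neutral ballI)
        fix k assume "k \<in> {2..<2 * int m}"
        then show "c (S k) * of_bool (int (2 * m) dvd e - k) = 0"
          using eq [of e k] \<open>e \<in> {0..<2}\<close> assms by auto
      qed
      ultimately show ?thesis using entry [of "d + j" j] d unfolding ij by simp
    qed
    moreover have "c (S s) = 0" if s: "s \<in> {2..<2 * int m}" for s
    proof -
      have "(\<Sum>k\<in>{2..<2 * int m}. c (S k) * of_bool (int (2 * m) dvd s - k))
          = (\<Sum>k\<in>{2..<2 * int m}. c (S k) * of_bool (k = s))"
        using s by (intro sum.cong refl) (subst eq, auto)
      then show ?thesis using entry [of s 0] s R0 by simp
    qed
    ultimately show ?thesis using v by (auto simp: vertex_basis_def)
  qed
  then show ?thesis unfolding dependent_finite [OF finite] by blast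
qed

text \<open>The two missing matrices \<open>S\<^sub>0\<close> and \<open>S\<^sub>1\<close> are recovered from the equality of the sum of the
  rotation matrices and the sum of the reflection matrices of the same parity.\<close>
lemma vertices_in_span:
  assumes "m \<ge> 2"
  shows "range R \<union> range S \<subseteq> span vertex_basis"
proof -
  have relation: "S e = (\<Sum>u\<in>{0..<int m}. R (2 * u + e)) - (\<Sum>v\<in>{1..<int m}. S (2 * v + e))" for e
  proof -
    have "(\<Sum>u\<in>{0..<int m}. R (2 * u + e)) = (\<Sum>v\<in>{0..<int m}. S (2 * v + e))"
      unfolding matrix_eq_iff_idx
    proof (intro allI)
      fix i j
      have "(\<Sum>u\<in>{0..<int m}. R (2 * u + e)) $ idx i $ idx j
          = (\<Sum>u\<in>{0..<int m}. of_bool (int (2 * m) dvd (i - j - e) - 2 * u))"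
        by (simp only: sum_component rot_matrix_idx) (simp add: algebra_simps)
      also have "\<dots> = (\<Sum>u\<in>{0..<int m}. of_bool (int (2 * m) dvd (i + j - e) - 2 * u))"
        by (simp only: sum_even_residues) simp
      also have "\<dots> = (\<Sum>v\<in>{0..<int m}. S (2 * v + e)) $ idx i $ idx j"
        by (simp only: sum_component refl_matrix_idx) (simp add: algebra_simps)
      finally show "(\<Sum>u\<in>{0..<int m}. R (2 * u + e)) $ idx i $ idx j
        = (\<Sum>v\<in>{0..<int m}. S (2 * v + e)) $ idx i $ idx j" .
    qed
    moreover have "{0..<int m} = insert 0 {1..<int m}" using m_pos by auto
    ultimately show ?thesis by simp
  qed
  have R: "R k \<in> span vertex_basis" if "k \<in> {0..<2 * int m}" for k
    using that by (intro span_base) (simp add: vertex_basis_def)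
  have S2: "S k \<in> span vertex_basis" if "k \<in> {2..<2 * int m}" for k
    using that by (intro span_base) (simp add: vertex_basis_def)
  have "S e \<in> span vertex_basis" if "e \<in> {0, 1}" for e
    by (subst relation, intro span_diff span_sum R S2) (use that in auto)
  then have S: "S k \<in> span vertex_basis" if "k \<in> {0..<2 * int m}" for k
    using that S2 [of k] by (cases "k \<in> {0, 1}") auto
  have dvd: "int (2 * m) dvd a - k mod int (2 * m) \<longleftrightarrow> int (2 * m) dvd a - k" for a k
    unfolding mod_eq_dvd_iff [symmetric] by (simp only: mod_mod_trivial)
  have R_mod: "R k = R (k mod int (2 * m))" and S_mod: "S k = S (k mod int (2 * m))" for k
    unfolding rot_matrix_def refl_matrix_def dvd by (rule refl)+
  have mod: "k mod int (2 * m) \<in> {0..<2 * int m}" for k using m_pos by simp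
  have "R k \<in> span vertex_basis" for k
    by (subst R_mod) (rule R [OF mod])
  moreover have "S k \<in> span vertex_basis" for k
    by (subst S_mod) (rule S [OF mod])
  ultimately show ?thesis by blast
qed

text \<open>Having column sum one is an affine condition that all permutation matrices satisfy.\<close>
lemma zero_notin_affine_hull_vertices: "0 \<notin> affine hull (range R \<union> range S)"
proof -
  let ?H = "{M :: real^'n^'n. (\<Sum>i\<in>UNIV. M $ i $ idx 0) = 1}"
  have "affine ?H"
    by (simp add: affine_def sum.distrib flip: sum_distrib_left)
  then have "affine hull (range R \<union> range S) \<subseteq> ?H"
    using column_sum_vertex by (intro hull_minimal) auto
  then show ?thesis by auto
qed

lemma aff_dim_DP:
  assumes "m \<ge> 2"
  shows "aff_dim (DP_poly (2 * m) ix) = 4 * int m - 3"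
proof -
  have "card vertex_basis = card {0..<2 * int m} + card {2..<2 * int m}"
    unfolding vertex_basis_def using vertices_distinct [OF assms]
    by (subst card_Un_disjoint) (auto simp: card_image)
  then have "card vertex_basis = 4 * m - 2" using assms by (simp add: nat_mult_distrib nat_diff_distrib)
  then have "dim (range R \<union> range S) = 4 * m - 2"
    using vertices_in_span [OF assms] independent_vertex_basis [OF assms]
    by (intro dim_unique [of vertex_basis]) (auto simp: vertex_basis_def)
  then show ?thesis
    using aff_dim_of_dim [OF zero_notin_affine_hull_vertices] assms
    by (simp add: DP_poly_eq aff_dim_convex_hull of_nat_diff)
qed

end

theorem theorem4p1:
  fixes n :: nat and ix :: "'n::finite \<Rightarrow> nat" and iy :: "'m::finite \<Rightarrow> nat"
  assumes "n \<ge> 4" and "even n"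
    and "bij_betw ix UNIV {1..n}"
    and "bij_betw iy UNIV {0..<n div 2}"
  shows "(\<exists>J :: ((real^'m^'m) \<times> (real^'m^'m) \<times> real) set.
            is_join (Q_poly iy) (Q_poly iy) J \<and> affinely_isomorphic (DP_poly n ix) J) \<and>
         aff_dim (DP_poly n ix) = 2 * int n - 3"
proof -
  obtain m where n: "n = 2 * m" using \<open>even n\<close> by blast
  interpret dihedral_join m ix iy
    using assms by unfold_locales (simp_all add: n)
  have "is_join (Q_poly iy) (Q_poly iy) (join_map ` DP_poly n ix)"
    unfolding n join_map_DP by (rule is_join_product)
  moreover have "affinely_isomorphic (DP_poly n ix) (join_map ` DP_poly n ix)"
    unfolding n by (rule affinely_isomorphic_join_map)
  moreover have "aff_dim (DP_poly n ix) = 2 * int n - 3"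
    using aff_dim_DP \<open>n \<ge> 4\<close> by (simp add: n)
  ultimately show ?thesis by blast
qed

end
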